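(* Let $\Gamma$ be a nut graph of odd order admitting a subgroup $G\le\mathrm{Aut}(\Gamma)$ that has exactly two orbits on the vertex set and exactly three orbits on the edge set of $\Gamma$, and let $V_1$ and $V_2$ be the two vertex orbits of $G$. Then $(V_1,V_2)$ is a bi-regular bi-decomposition of $\Gamma$. Let $\langle n_1,k_1,d_1,n_2,k_2,d_2\rangle$ be the corresponding parameter $6$-tuple, set $\Gamma_1=\Gamma[V_1]$ and $\Gamma_2=\Gamma[V_2]$, and let $\mathbf{x}$ be a kernel eigenvector of $\Gamma$. Then the following hold. (a) For each $i\in\{1,2\}$, the entries of $\mathbf{x}$ corresponding to the vertices of $\Gamma_i$ are all equal. Moreover, we can assume (after multiplying $\mathbf{x}$ by a suitable nonzero scalar) that $\mathbf{x}(v)=1$ for all $v\in V_1$ and $\mathbf{x}(v)=-k_1/d_1$ for all $v\in V_2$. (b) $k_1k_2=d_1d_2$, and $k_1,k_2,d_1,d_2\ge 1$. (c) $\gcd(n_1,n_2)\ne 1$.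
   Context: A nut graph is a finite simple graph whose adjacency matrix has a one-dimensional null space spanned by a vector with no zero entries. A kernel eigenvector of $\Gamma$ is an eigenvector of its adjacency matrix for the eigenvalue $0$; $\mathbf{x}(v)$ is its entry at the vertex $v$. $\Gamma[W]$ denotes the subgraph induced on $W$. A simple graph $\Gamma$ admits a bi-regular bi-decomposition $(V_1,V_2)$ if its vertex set is the disjoint union $V_1\cup V_2$ and there are nonnegative integers $k_1,k_2,d_1,d_2$ such that for each $i\in\{1,2\}$ the induced subgraph $\Gamma[V_i]$ is $k_i$-regular, and for distinct $i,i'\in\{1,2\}$ each vertex in $V_i$ has exactly $d_i$ neighbors in $V_{i'}$. With $n_i=|V_i|$, the $6$-tuple $\langle n_1,k_1,d_1,n_2,k_2,d_2\rangle$ is the corresponding parameter $6$-tuple. *)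

theory Defs
  imports "HOL-Analysis.Analysis" "HOL-Algebra.Group_Action"
begin

text \<open>
  A finite graph is given by its edge set; its vertex set is the whole finite vertex type
  \<^typ>\<open>'v\<close>, so that the adjacency matrix and its kernel vectors are indexed by \<^typ>\<open>'v\<close>.
  Subgraphs have a smaller vertex set \<open>W\<close>, which is then passed explicitly.
\<close>

definition simple_graph :: "'v::finite set set \<Rightarrow> bool" where
  "simple_graph E \<longleftrightarrow> (\<forall>e\<in>E. card e = 2)"

definition adjacency_matrix :: "'v::finite set set \<Rightarrow> real^'v^'v" where
  "adjacency_matrix E = (\<chi> u v. if {u, v} \<in> E then 1 else 0)"

definition null_space :: "real^'v^'v \<Rightarrow> (real^'v) set" where
  "null_space A = {x. A *v x = 0}"

definition nut_graph :: "'v::finite set set \<Rightarrow> bool" where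
  "nut_graph E \<longleftrightarrow> simple_graph E \<and>
     dim (null_space (adjacency_matrix E)) = 1 \<and>
     (\<exists>x. (\<forall>v. x $ v \<noteq> 0) \<and> null_space (adjacency_matrix E) = span {x})"

definition kernel_eigenvector :: "'v::finite set set \<Rightarrow> real^'v \<Rightarrow> bool" where
  "kernel_eigenvector E x \<longleftrightarrow> x \<noteq> 0 \<and> adjacency_matrix E *v x = 0 *s x"

definition aut_group :: "'v::finite set set \<Rightarrow> ('v \<Rightarrow> 'v) monoid" where
  "aut_group E = BijGroup UNIV
     \<lparr>carrier := {p \<in> Bij UNIV. \<forall>u v. {p u, p v} \<in> E \<longleftrightarrow> {u, v} \<in> E}\<rparr>"

definition vertex_orbits :: "'v::finite set set \<Rightarrow> ('v \<Rightarrow> 'v) set \<Rightarrow> 'v set set" where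
  "vertex_orbits E G = orbits (aut_group E\<lparr>carrier := G\<rparr>) UNIV (\<lambda>p. p)"

definition edge_orbits :: "'v::finite set set \<Rightarrow> ('v \<Rightarrow> 'v) set \<Rightarrow> 'v set set set" where
  "edge_orbits E G = orbits (aut_group E\<lparr>carrier := G\<rparr>) E (\<lambda>p. image p)"

text \<open>Edge set of the subgraph induced on \<open>W\<close>.\<close>

definition induced_edges :: "'v set set \<Rightarrow> 'v set \<Rightarrow> 'v set set" where
  "induced_edges E W = {e \<in> E. e \<subseteq> W}"

text \<open>\<open>k\<close>-regularity of the graph with vertex set \<open>W\<close> and edge set \<open>F\<close>.\<close>

definition regular_graph :: "'v set \<Rightarrow> 'v set set \<Rightarrow> nat \<Rightarrow> bool" where
  "regular_graph W F k \<longleftrightarrow> (\<forall>v\<in>W. card {u \<in> W. {v, u} \<in> F} = k)"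

definition has_parameters ::
  "'v set set \<Rightarrow> 'v set \<Rightarrow> 'v set \<Rightarrow> nat \<times> nat \<times> nat \<times> nat \<times> nat \<times> nat \<Rightarrow> bool" where
  "has_parameters E V1 V2 = (\<lambda>(n1, k1, d1, n2, k2, d2).
     n1 = card V1 \<and> n2 = card V2 \<and>
     regular_graph V1 (induced_edges E V1) k1 \<and>
     regular_graph V2 (induced_edges E V2) k2 \<and>
     (\<forall>v\<in>V1. card {u \<in> V2. {v, u} \<in> E} = d1) \<and>
     (\<forall>v\<in>V2. card {u \<in> V1. {v, u} \<in> E} = d2))"

definition biregular_bidecomposition :: "'v set set \<Rightarrow> 'v set \<Rightarrow> 'v set \<Rightarrow> bool" where
  "biregular_bidecomposition E V1 V2 \<longleftrightarrow>
     V1 \<union> V2 = UNIV \<and> V1 \<inter> V2 = {} \<and>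
     (\<exists>n1 k1 d1 n2 k2 d2. has_parameters E V1 V2 (n1, k1, d1, n2, k2, d2))"

end

theory Submission
  imports Defs
begin

text \<open>
  Everything rests on one fact: in a nut graph of odd order every automorphism fixes every kernel
  eigenvector \<open>x\<close> (\<open>automorphism_fixes_kernel_eigenvector\<close>). As the kernel is a line, an
  automorphism \<open>p\<close> multiplies \<open>x\<close> by a scalar, and since \<open>p\<close> only permutes the entries this scalar
  is \<open>\<plusminus>1\<close>. The scalar \<open>-1\<close> would make \<open>p\<close> exchange the positive and the negative entries; as no entry is
  zero, the order would be even.

  Hence, the group being transitive on each orbit, \<open>x\<close> takes a single nonzero value \<open>a\<close> on \<open>V\<^sub>1\<close> and \<open>b\<close> on \<open>V\<^sub>2\<close>. The number of neighbours of a
  vertex inside an orbit depends only on the orbit of the vertex, so the two orbits form a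
  bi-regular bi-decomposition, and the kernel equations collapse to the two equations
  \<open>k\<^sub>1 a + d\<^sub>1 b = 0\<close> and \<open>d\<^sub>2 a + k\<^sub>2 b = 0\<close>. They give \<open>k\<^sub>1 k\<^sub>2 = d\<^sub>1 d\<^sub>2\<close> and \<open>b / a = - k\<^sub>1 / d\<^sub>1\<close>, and
  together with the edge count \<open>n\<^sub>1 d\<^sub>1 = n\<^sub>2 d\<^sub>2\<close> they show that if one of the four parameters
  \<open>k\<^sub>1, d\<^sub>1, k\<^sub>2, d\<^sub>2\<close> vanishes, then all do. The latter is impossible because the graph has edges.

  Finally, if \<open>n\<^sub>1\<close> and \<open>n\<^sub>2\<close> were coprime, then the edge count would force \<open>n\<^sub>2\<close> to divide \<open>d\<^sub>1\<close> and
  \<open>n\<^sub>1\<close> to divide \<open>d\<^sub>2\<close>, so \<open>k\<^sub>1 k\<^sub>2 = d\<^sub>1 d\<^sub>2 \<ge> n\<^sub>1 n\<^sub>2\<close>, contradicting \<open>k\<^sub>i < n\<^sub>i\<close>.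
\<close>

section \<open>Kernel eigenvectors of nut graphs\<close>

lemma adjacency_matrix_mult_nth:
  "(adjacency_matrix E *v x) $ v = (\<Sum>u | {v, u} \<in> E. x $ u)"
  by (simp add: adjacency_matrix_def matrix_vector_mult_def if_distrib[of "\<lambda>t. t * _"]
      sum.If_cases cong: if_cong)

lemma kernel_eigenvector_iff:
  "kernel_eigenvector E x \<longleftrightarrow> x \<noteq> 0 \<and> (\<forall>v. (\<Sum>u | {v, u} \<in> E. x $ u) = 0)"
  by (simp add: kernel_eigenvector_def vec_eq_iff[of "_ *v _"] adjacency_matrix_mult_nth)

lemma kernel_eigenvector_in_null_space:
  "kernel_eigenvector E x \<longleftrightarrow> x \<noteq> 0 \<and> x \<in> null_space (adjacency_matrix E)"
  by (simp add: kernel_eigenvector_def null_space_def)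

lemma nut_graph_kernel_eigenvector:
  assumes "nut_graph E" "kernel_eigenvector E x"
  shows "x $ v \<noteq> 0" and "null_space (adjacency_matrix E) = range (\<lambda>c. c *s x)"
proof -
  obtain z where z: "\<And>v. z $ v \<noteq> 0" "null_space (adjacency_matrix E) = range (\<lambda>c. c *s z)"
    using assms(1) unfolding nut_graph_def
    by (auto simp: span_singleton scalar_mult_eq_scaleR)
  then obtain c where c: "x = c *s z" "c \<noteq> 0"
    using assms(2) by (auto simp: kernel_eigenvector_in_null_space)
  show "x $ v \<noteq> 0"
    using z(1) c by simp
  have "d *s z = (d / c) *s x" for d
    using c(2) by (simp add: c(1))
  moreover have "d *s x = (d * c) *s z" for d
    by (simp add: c(1))
  ultimately show "null_space (adjacency_matrix E) = range (\<lambda>c. c *s x)"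
    unfolding z(2) by blast
qed

lemma kernel_eigenvector_permuted:
  assumes "kernel_eigenvector E x" "bij p" "\<And>u v. {p u, p v} \<in> E \<longleftrightarrow> {u, v} \<in> E"
  shows "(\<chi> v. x $ p v) \<in> null_space (adjacency_matrix E)"
proof -
  have "(\<Sum>u | {v, u} \<in> E. x $ p u) = (\<Sum>u | {p v, u} \<in> E. x $ u)" for v
  proof (rule sum.reindex_bij_betw)
    have "p ` {u. {v, u} \<in> E} = {u. {p v, u} \<in> E}"
      using assms(2,3) by (auto simp: image_iff) (metis bij_pointE)
    then show "bij_betw p {u. {v, u} \<in> E} {u. {p v, u} \<in> E}"
      using assms(2) by (auto simp: bij_betw_def intro: inj_on_subset)
  qed
  then show ?thesis
    using assms(1) by (simp add: null_space_def vec_eq_iff[of "_ *v _"] adjacency_matrix_mult_nth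
        kernel_eigenvector_iff)
qed

text \<open>Permuting the entries preserves the sum of their squares.\<close>

lemma permuted_multiple_square_eq_one:
  fixes f :: "'v::finite \<Rightarrow> real"
  assumes "bij p" "\<And>v. f (p v) = c * f v" "f w \<noteq> 0"
  shows "c\<^sup>2 = 1"
proof -
  have "(\<Sum>v\<in>UNIV. (f v)\<^sup>2) = (\<Sum>v\<in>UNIV. (f (p v))\<^sup>2)"
    using sum.reindex_bij_betw[OF assms(1), of "\<lambda>v. (f v)\<^sup>2"] by simp
  also have "\<dots> = c\<^sup>2 * (\<Sum>v\<in>UNIV. (f v)\<^sup>2)"
    by (simp add: assms(2) power_mult_distrib sum_distrib_left)
  finally have "(\<Sum>v\<in>UNIV. (f v)\<^sup>2) = c\<^sup>2 * (\<Sum>v\<in>UNIV. (f v)\<^sup>2)" .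
  moreover have "(\<Sum>v\<in>UNIV. (f v)\<^sup>2) > 0"
    using assms(3) by (intro sum_pos2[of _ w]) auto
  ultimately show ?thesis by simp
qed

text \<open>The permutation matches the positive values with the negative ones.\<close>

lemma even_card_if_sign_reversing:
  fixes f :: "'v::finite \<Rightarrow> real"
  assumes "bij p" "\<And>v. f (p v) = - f v" "\<And>v. f v \<noteq> 0"
  shows "even CARD('v)"
proof -
  have "p ` {v. f v > 0} = {v. f v < 0}"
  proof (intro equalityI subsetI)
    fix w assume "w \<in> {v. f v < 0}"
    moreover obtain v where "w = p v"
      using assms(1) by (metis bij_pointE)
    ultimately show "w \<in> p ` {v. f v > 0}"
      using assms(2)[of v] by auto
  qed (auto simp: assms(2))
  then have "bij_betw p {v. f v > 0} {v. f v < 0}"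
    using assms(1) by (auto simp: bij_betw_def intro: inj_on_subset)
  then have "card {v. f v > 0} = card {v. f v < 0}"
    by (rule bij_betw_same_card)
  moreover have "CARD('v) = card ({v. f v > 0} \<union> {v. f v < 0})"
    using assms(3) by (intro arg_cong[of _ _ card]) (auto simp: neq_iff)
  then have "CARD('v) = card {v. f v > 0} + card {v. f v < 0}"
    by (subst (asm) card_Un_disjoint) auto
  ultimately show ?thesis by simp
qed

lemma automorphism_fixes_kernel_eigenvector:
  fixes E :: "'v::finite set set"
  assumes "nut_graph E" "odd CARD('v)" "kernel_eigenvector E x"
    and "bij p" "\<And>u v. {p u, p v} \<in> E \<longleftrightarrow> {u, v} \<in> E"
  shows "x $ p v = x $ v"
proof -
  obtain c where "(\<chi> v. x $ p v) = c *s x"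
    using kernel_eigenvector_permuted[OF assms(3-5)]
      nut_graph_kernel_eigenvector(2)[OF assms(1,3)] by auto
  then have c: "x $ p v = c * x $ v" for v
    by (simp add: vec_eq_iff)
  have nz: "x $ v \<noteq> 0" for v
    using assms(1,3) by (rule nut_graph_kernel_eigenvector)
  have "c\<^sup>2 = 1"
    using permuted_multiple_square_eq_one[of p "($) x", OF assms(4) c nz] .
  moreover have "c \<noteq> - 1"
    using even_card_if_sign_reversing[of p "($) x"] assms(2,4) c nz by auto
  ultimately show ?thesis
    using c by (auto simp: power2_eq_1_iff)
qed

section \<open>Vertex orbits of a group of automorphisms\<close>

lemma edge_preserving_maps_subgroup:
  "subgroup {p \<in> Bij UNIV. \<forall>u v. {p u, p v} \<in> E \<longleftrightarrow> {u, v} \<in> E} (BijGroup UNIV)"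
proof (rule subgroup.intro)
  fix p assume p: "p \<in> {p \<in> Bij UNIV. \<forall>u v. {p u, p v} \<in> E \<longleftrightarrow> {u, v} \<in> E}"
  then have "p (inv_into UNIV p u) = u" for u
    by (simp add: Bij_def bij_betw_def surj_f_inv_f)
  then have "{inv_into UNIV p u, inv_into UNIV p v} \<in> E \<longleftrightarrow> {u, v} \<in> E" for u v
    using p by (metis (mono_tags, lifting) mem_Collect_eq)
  then show "inv\<^bsub>BijGroup UNIV\<^esub> p \<in> {p \<in> Bij UNIV. \<forall>u v. {p u, p v} \<in> E \<longleftrightarrow> {u, v} \<in> E}"
    using p restrict_inv_into_Bij[of p UNIV] by (simp add: inv_BijGroup)
next
  fix p q
  assume "p \<in> {p \<in> Bij UNIV. \<forall>u v. {p u, p v} \<in> E \<longleftrightarrow> {u, v} \<in> E}"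
    "q \<in> {p \<in> Bij UNIV. \<forall>u v. {p u, p v} \<in> E \<longleftrightarrow> {u, v} \<in> E}"
  then show "p \<otimes>\<^bsub>BijGroup UNIV\<^esub> q \<in> {p \<in> Bij UNIV. \<forall>u v. {p u, p v} \<in> E \<longleftrightarrow> {u, v} \<in> E}"
    using compose_Bij[of p UNIV q] by (simp add: BijGroup_def compose_eq)
qed (use id_Bij[of UNIV] in \<open>auto simp: BijGroup_def\<close>)

lemma aut_group_natural_action:
  assumes "subgroup G (aut_group E)"
  shows "group_action (aut_group E\<lparr>carrier := G\<rparr>) UNIV (\<lambda>p. p)"
proof -
  have "subgroup G (BijGroup UNIV)"
    using group.incl_subgroup[OF group_BijGroup edge_preserving_maps_subgroup] assms
    unfolding aut_group_def by blast
  then have "group_hom (BijGroup UNIV\<lparr>carrier := G\<rparr>) (BijGroup UNIV) id"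
    by (rule group.canonical_inj_is_hom[OF group_BijGroup])
  then show ?thesis
    by (simp add: group_action_def aut_group_def id_def)
qed

lemma subgroup_aut_groupD:
  assumes "subgroup G (aut_group E)" "p \<in> G"
  shows "bij p" and "{p u, p v} \<in> E \<longleftrightarrow> {u, v} \<in> E"
  using subgroup.subset[OF assms(1)] assms(2) by (auto simp: aut_group_def Bij_def)

lemma partition_of_two_vertex_orbits:
  assumes "subgroup G (aut_group E)" "vertex_orbits E G = {V1, V2}" "V1 \<noteq> V2"
  shows "V1 \<union> V2 = UNIV" "V1 \<inter> V2 = {}"
proof -
  interpret group_action "aut_group E\<lparr>carrier := G\<rparr>" UNIV "\<lambda>p. p"
    using assms(1) by (rule aut_group_natural_action)
  show "V1 \<union> V2 = UNIV"
    using orbits_coverture assms(2) by (simp add: vertex_orbits_def)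
  show "V1 \<inter> V2 = {}"
    using disjoint_union[of V1 V2] assms(2,3) by (simp add: vertex_orbits_def)
qed

lemma vertex_orbit_nonempty:
  assumes "subgroup G (aut_group E)" "V \<in> vertex_orbits E G"
  shows "V \<noteq> {}"
  using assms subgroup.one_closed[OF assms(1)]
  by (auto simp: vertex_orbits_def orbits_def orbit_def)

lemma vertex_orbit_transitive:
  assumes "subgroup G (aut_group E)" "V \<in> vertex_orbits E G" "u \<in> V" "v \<in> V"
  obtains p where "p \<in> G" "v = p u"
proof -
  interpret group_action "aut_group E\<lparr>carrier := G\<rparr>" UNIV "\<lambda>p. p"
    using assms(1) by (rule aut_group_natural_action)
  obtain w where "u \<in> orbit (aut_group E\<lparr>carrier := G\<rparr>) (\<lambda>p. p) w"
    "v \<in> orbit (aut_group E\<lparr>carrier := G\<rparr>) (\<lambda>p. p) w"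
    using assms by (auto simp: vertex_orbits_def orbits_def)
  then have "v \<in> orbit (aut_group E\<lparr>carrier := G\<rparr>) (\<lambda>p. p) u"
    using orbit_sym orbit_trans by blast
  then show thesis
    using that by (auto simp: orbit_def)
qed

text \<open>
  The inclusion \<open>p ` V \<subseteq> V\<close> is closure under composition. Equality is then automatic, because \<open>p\<close> is
  injective and \<open>V\<close> is finite.
\<close>

lemma vertex_orbit_invariant:
  fixes E :: "'v::finite set set"
  assumes "subgroup G (aut_group E)" "V \<in> vertex_orbits E G" "p \<in> G"
  shows "p ` V = V"
proof -
  interpret group_action "aut_group E\<lparr>carrier := G\<rparr>" UNIV "\<lambda>p. p"
    using assms(1) by (rule aut_group_natural_action)
  obtain w where w: "V = orbit (aut_group E\<lparr>carrier := G\<rparr>) (\<lambda>p. p) w"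
    using assms(2) by (auto simp: vertex_orbits_def orbits_def)
  have "p ` V \<subseteq> V"
  proof
    fix v assume "v \<in> p ` V"
    then obtain u where u: "u \<in> V" "v = p u" by blast
    then have "v \<in> orbit (aut_group E\<lparr>carrier := G\<rparr>) (\<lambda>p. p) u"
      using assms(3) by (auto simp: orbit_def)
    then show "v \<in> V"
      using u(1) orbit_trans unfolding w by blast
  qed
  moreover have "inj_on p V"
    using subgroup_aut_groupD(1)[OF assms(1,3)] by (auto simp: bij_def intro: inj_on_subset)
  ultimately show ?thesis
    by (intro endo_inj_surj) auto
qed

text \<open>
  An automorphism in \<open>G\<close> taking \<open>v\<close> to \<open>w\<close> maps \<open>W\<close> onto itself, hence the neighbours of \<open>v\<close> in \<open>W\<close> onto
  those of \<open>w\<close>.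
\<close>

lemma card_neighbours_in_orbit_const:
  fixes E :: "'v::finite set set"
  assumes "subgroup G (aut_group E)" "V \<in> vertex_orbits E G" "W \<in> vertex_orbits E G"
  shows "\<exists>k. \<forall>v\<in>V. card {u \<in> W. {v, u} \<in> E} = k"
proof -
  have "card {u \<in> W. {v, u} \<in> E} = card {u \<in> W. {w, u} \<in> E}" if vw: "v \<in> V" "w \<in> V" for v w
  proof -
    obtain p where p: "p \<in> G" "w = p v"
      using vertex_orbit_transitive[OF assms(1,2) vw] .
    have W: "p ` W = W"
      using assms(1,3) p(1) by (rule vertex_orbit_invariant)
    note aut = subgroup_aut_groupD[OF assms(1) p(1)]
    have "{u \<in> W. {w, u} \<in> E} = p ` {u \<in> W. {v, u} \<in> E}"
    proof (intro equalityI subsetI)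
      fix u assume u: "u \<in> {u \<in> W. {w, u} \<in> E}"
      then obtain u' where "u' \<in> W" "u = p u'"
        using W by blast
      then show "u \<in> p ` {u \<in> W. {v, u} \<in> E}"
        using u p(2) aut(2) by auto
    qed (use W p(2) aut(2) in auto)
    moreover have "inj_on p {u \<in> W. {v, u} \<in> E}"
      using aut(1) by (auto simp: bij_def intro: inj_on_subset)
    ultimately show ?thesis
      by (simp add: card_image)
  qed
  then show ?thesis by (cases "V = {}") blast+
qed

section \<open>Bi-regular bi-decompositions\<close>

lemma regular_graph_induced_iff:
  "regular_graph W (induced_edges E W) k \<longleftrightarrow> (\<forall>v\<in>W. card {u \<in> W. {v, u} \<in> E} = k)"
proof -
  have "{u \<in> W. {v, u} \<in> induced_edges E W} = {u \<in> W. {v, u} \<in> E}" if "v \<in> W" for v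
    using that by (auto simp: induced_edges_def)
  then show ?thesis by (simp add: regular_graph_def)
qed

lemma biregular_bidecomposition_vertex_orbits:
  fixes E :: "'v::finite set set"
  assumes "subgroup G (aut_group E)" "vertex_orbits E G = {V1, V2}" "V1 \<noteq> V2"
  shows "biregular_bidecomposition E V1 V2"
proof -
  have V: "V1 \<in> vertex_orbits E G" "V2 \<in> vertex_orbits E G"
    using assms(2) by auto
  note const = card_neighbours_in_orbit_const[OF assms(1)]
  obtain k1 d1 k2 d2 where "\<forall>v\<in>V1. card {u \<in> V1. {v, u} \<in> E} = k1"
    "\<forall>v\<in>V1. card {u \<in> V2. {v, u} \<in> E} = d1" "\<forall>v\<in>V2. card {u \<in> V2. {v, u} \<in> E} = k2"
    "\<forall>v\<in>V2. card {u \<in> V1. {v, u} \<in> E} = d2"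
    using const[OF V(1) V(1)] const[OF V(1) V(2)] const[OF V(2) V(2)] const[OF V(2) V(1)] by blast
  then have "has_parameters E V1 V2 (card V1, k1, d1, card V2, k2, d2)"
    by (simp add: has_parameters_def regular_graph_induced_iff)
  then show ?thesis
    using partition_of_two_vertex_orbits[OF assms] by (auto simp: biregular_bidecomposition_def)
qed

lemma has_parameters_swap:
  "has_parameters E V1 V2 (n1, k1, d1, n2, k2, d2) \<Longrightarrow>
   has_parameters E V2 V1 (n2, k2, d2, n1, k1, d1)"
  by (simp add: has_parameters_def)

text \<open>Both sides count the edges between the two parts.\<close>

lemma has_parameters_edge_count:
  fixes E :: "'v::finite set set"
  assumes "has_parameters E V1 V2 (n1, k1, d1, n2, k2, d2)"
  shows "n1 * d1 = n2 * d2"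
proof -
  have "(\<Sum>v\<in>V1. card {u \<in> V2. {v, u} \<in> E}) = d2 * card V2"
    using assms by (intro sum_multicount) (auto simp: has_parameters_def insert_commute)
  then show ?thesis
    using assms by (simp add: has_parameters_def mult.commute)
qed

text \<open>There are no loops, so a vertex is not among its own neighbours.\<close>

lemma has_parameters_less:
  fixes E :: "'v::finite set set"
  assumes "simple_graph E" "has_parameters E V1 V2 (n1, k1, d1, n2, k2, d2)" "V1 \<noteq> {}"
  shows "k1 < n1"
proof -
  obtain v where v: "v \<in> V1" using assms(3) by blast
  have "{v, v} \<notin> E"
    using assms(1) by (force simp: simple_graph_def)
  then have "{u \<in> V1. {v, u} \<in> E} \<subset> V1"
    using v by blast
  then have "card {u \<in> V1. {v, u} \<in> E} < card V1"
    by (intro psubset_card_mono) auto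
  then show ?thesis
    using assms(2) v by (simp add: has_parameters_def regular_graph_induced_iff)
qed

lemma has_parameters_kernel_equation:
  fixes E :: "'v::finite set set"
  assumes "has_parameters E V1 V2 (n1, k1, d1, n2, k2, d2)" "V1 \<noteq> {}"
    and "V1 \<union> V2 = UNIV" "V1 \<inter> V2 = {}"
    and "kernel_eigenvector E x" "\<And>v. v \<in> V1 \<Longrightarrow> x $ v = a" "\<And>v. v \<in> V2 \<Longrightarrow> x $ v = b"
  shows "real k1 * a + real d1 * b = 0"
proof -
  obtain v where v: "v \<in> V1" using assms(2) by blast
  have "{u. {v, u} \<in> E} = {u \<in> V1. {v, u} \<in> E} \<union> {u \<in> V2. {v, u} \<in> E}"
    using assms(3) by blast
  then have "(\<Sum>u | {v, u} \<in> E. x $ u) =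
      (\<Sum>u\<in>{u \<in> V1. {v, u} \<in> E}. x $ u) + (\<Sum>u\<in>{u \<in> V2. {v, u} \<in> E}. x $ u)"
    using assms(4) by (simp add: sum.union_disjoint disjoint_iff)
  also have "\<dots> = real k1 * a + real d1 * b"
    using assms(1,6,7) v by (simp add: has_parameters_def regular_graph_induced_iff)
  finally show ?thesis
    using assms(5) by (simp add: kernel_eigenvector_iff)
qed

lemma has_parameters_some_edge:
  fixes E :: "'v::finite set set"
  assumes "simple_graph E" "E \<noteq> {}" "V1 \<union> V2 = UNIV"
    and "has_parameters E V1 V2 (n1, k1, d1, n2, k2, d2)"
  shows "k1 \<noteq> 0 \<or> d1 \<noteq> 0 \<or> k2 \<noteq> 0 \<or> d2 \<noteq> 0"
proof -
  obtain e where e: "e \<in> E" using assms(2) by blast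
  then have "card e = 2" using assms(1) by (simp add: simple_graph_def)
  with e obtain u v where uv: "{v, u} \<in> E"
    by (auto simp: card_2_iff)
  have "u \<in> V1 \<or> u \<in> V2" "v \<in> V1 \<or> v \<in> V2" using assms(3) by auto
  moreover have "card {w \<in> W. {v, w} \<in> E} \<noteq> 0" if "u \<in> W" for W
    using that uv by auto
  moreover have "\<forall>v\<in>V1. card {u \<in> V1. {v, u} \<in> E} = k1" "\<forall>v\<in>V1. card {u \<in> V2. {v, u} \<in> E} = d1"
    "\<forall>v\<in>V2. card {u \<in> V2. {v, u} \<in> E} = k2" "\<forall>v\<in>V2. card {u \<in> V1. {v, u} \<in> E} = d2"
    using assms(4) by (simp_all add: has_parameters_def regular_graph_induced_iff)
  ultimately show ?thesis by metis
qed

lemma coprime_imp_product_le: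
  fixes n1 n2 d1 d2 :: nat
  assumes "coprime n1 n2" "n1 * d1 = n2 * d2" "d1 > 0" "d2 > 0"
  shows "n1 * n2 \<le> d1 * d2"
proof -
  have "n2 dvd d1"
    using assms(1,2) by (metis coprime_commute coprime_dvd_mult_right_iff dvd_triv_left)
  moreover have "n1 dvd d2"
    using assms(1,2) by (metis coprime_dvd_mult_right_iff dvd_triv_left)
  ultimately have "n2 \<le> d1" "n1 \<le> d2"
    using assms(3,4) by (auto intro: dvd_imp_le)
  then show ?thesis
    by (metis mult.commute mult_le_mono)
qed

section \<open>The parameters of the orbit decomposition\<close>

text \<open>
  The two linear equations make \<open>k\<^sub>i\<close> and \<open>d\<^sub>i\<close> vanish together, and the edge count does the same for \<open>d\<^sub>1\<close>
  and \<open>d\<^sub>2\<close>; so a single nonzero parameter makes all of them positive.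
\<close>

lemma quotient_parameters:
  fixes a b :: real and n1 n2 k1 k2 d1 d2 :: nat
  assumes eqs: "real k1 * a + real d1 * b = 0" "real k2 * b + real d2 * a = 0"
    and nz: "a \<noteq> 0" "b \<noteq> 0"
    and count: "n1 * d1 = n2 * d2" "n1 > 0" "n2 > 0"
    and edge: "k1 \<noteq> 0 \<or> d1 \<noteq> 0 \<or> k2 \<noteq> 0 \<or> d2 \<noteq> 0"
  shows "k1 * k2 = d1 * d2" and "k1 \<ge> 1 \<and> k2 \<ge> 1 \<and> d1 \<ge> 1 \<and> d2 \<ge> 1"
    and "b / a = - (real k1 / real d1)"
proof -
  have "(real k1 * real k2) * a = (real k1 * a) * real k2" by simp
  also have "\<dots> = - (real d1 * (real k2 * b))"
    using eqs(1) by (simp add: eq_neg_iff_add_eq_0[symmetric])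
  also have "\<dots> = (real d1 * real d2) * a"
    using eqs(2) by (simp add: eq_neg_iff_add_eq_0[symmetric])
  finally have "real (k1 * k2) = real (d1 * d2)"
    using nz(1) by simp
  then show "k1 * k2 = d1 * d2" by (rule of_nat_eq_iff[THEN iffD1])
  have "k1 = 0 \<longleftrightarrow> d1 = 0" "k2 = 0 \<longleftrightarrow> d2 = 0"
    using eqs nz by auto
  moreover have "d1 = 0 \<longleftrightarrow> d2 = 0"
    using count by auto
  ultimately show pos: "k1 \<ge> 1 \<and> k2 \<ge> 1 \<and> d1 \<ge> 1 \<and> d2 \<ge> 1"
    using edge by (auto simp: Suc_le_eq)
  show "b / a = - (real k1 / real d1)"
    using eqs(1) nz(1) pos by (simp add: field_simps)
qed

theorem lemma3p1:
  fixes E :: "'v::finite set set"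
    and G :: "('v \<Rightarrow> 'v) set"
    and V1 V2 :: "'v set"
  assumes nut: "nut_graph E"
    and odd_order: "odd CARD('v)"
    and subgroup: "subgroup G (aut_group E)"
    and vertex_orbits: "vertex_orbits E G = {V1, V2}" "V1 \<noteq> V2"
    and edge_orbits: "card (edge_orbits E G) = 3"
  shows "biregular_bidecomposition E V1 V2 \<and>
    (\<forall>n1 k1 d1 n2 k2 d2. has_parameters E V1 V2 (n1, k1, d1, n2, k2, d2) \<longrightarrow>
       (\<forall>x. kernel_eigenvector E x \<longrightarrow>
          (\<forall>u\<in>V1. \<forall>v\<in>V1. x $ u = x $ v) \<and>
          (\<forall>u\<in>V2. \<forall>v\<in>V2. x $ u = x $ v) \<and>
          (\<exists>c. c \<noteq> 0 \<and>
             (\<forall>v\<in>V1. (c *s x) $ v = 1) \<and>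
             (\<forall>v\<in>V2. (c *s x) $ v = - (real k1 / real d1)))) \<and>
       (k1 * k2 = d1 * d2 \<and> k1 \<ge> 1 \<and> k2 \<ge> 1 \<and> d1 \<ge> 1 \<and> d2 \<ge> 1) \<and>
       gcd n1 n2 \<noteq> 1)"
proof -
  have V: "V1 \<in> vertex_orbits E G" "V2 \<in> vertex_orbits E G"
    using vertex_orbits(1) by auto
  note ne = vertex_orbit_nonempty[OF subgroup V(1)] vertex_orbit_nonempty[OF subgroup V(2)]
  note part = partition_of_two_vertex_orbits[OF subgroup vertex_orbits]
  have simple: "simple_graph E"
    using nut by (simp add: nut_graph_def)
  have edges: "E \<noteq> {}"
    using edge_orbits by (auto simp: edge_orbits_def orbits_def)
  obtain y where y: "kernel_eigenvector E y"
  proof -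
    obtain z where "\<forall>v. z $ v \<noteq> 0" "null_space (adjacency_matrix E) = span {z}"
      using nut by (auto simp: nut_graph_def)
    then have "kernel_eigenvector E z"
      by (auto simp: kernel_eigenvector_in_null_space span_base)
    then show thesis by (rule that)
  qed
  have const: "x $ u = x $ v"
    if x: "kernel_eigenvector E x" and W: "W \<in> vertex_orbits E G" "u \<in> W" "v \<in> W" for x W u v
  proof -
    obtain p where p: "p \<in> G" "v = p u"
      using vertex_orbit_transitive[OF subgroup W] .
    show ?thesis
      using automorphism_fixes_kernel_eigenvector[OF nut odd_order x
          subgroup_aut_groupD[OF subgroup p(1)]] p(2) by simp
  qed
  obtain v1 v2 where v: "v1 \<in> V1" "v2 \<in> V2"
    using ne by blast
  have "(\<forall>x. kernel_eigenvector E x \<longrightarrow>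
          (\<forall>u\<in>V1. \<forall>v\<in>V1. x $ u = x $ v) \<and>
          (\<forall>u\<in>V2. \<forall>v\<in>V2. x $ u = x $ v) \<and>
          (\<exists>c. c \<noteq> 0 \<and>
             (\<forall>v\<in>V1. (c *s x) $ v = 1) \<and>
             (\<forall>v\<in>V2. (c *s x) $ v = - (real k1 / real d1)))) \<and>
       (k1 * k2 = d1 * d2 \<and> k1 \<ge> 1 \<and> k2 \<ge> 1 \<and> d1 \<ge> 1 \<and> d2 \<ge> 1) \<and>
       gcd n1 n2 \<noteq> 1"
    if par: "has_parameters E V1 V2 (n1, k1, d1, n2, k2, d2)" for n1 k1 d1 n2 k2 d2
  proof -
    note count = has_parameters_edge_count[OF par]
    have n: "n1 > 0" "n2 > 0"
      using par ne by (auto simp: has_parameters_def card_gt_0_iff)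
    have parameters: "k1 * k2 = d1 * d2" "k1 \<ge> 1 \<and> k2 \<ge> 1 \<and> d1 \<ge> 1 \<and> d2 \<ge> 1"
        "x $ v2 / x $ v1 = - (real k1 / real d1)" if x: "kernel_eigenvector E x" for x
    proof -
      have vals: "w \<in> V1 \<Longrightarrow> x $ w = x $ v1" "w \<in> V2 \<Longrightarrow> x $ w = x $ v2" for w
        using const[OF x] V v by blast+
      have 1: "real k1 * x $ v1 + real d1 * x $ v2 = 0"
        using par ne(1) part x vals by (rule has_parameters_kernel_equation)
      have 2: "real k2 * x $ v2 + real d2 * x $ v1 = 0"
        using has_parameters_kernel_equation[OF has_parameters_swap[OF par] ne(2)] part x vals
        by (simp add: Un_commute Int_commute)
      note q = quotient_parameters[OF 1 2 nut_graph_kernel_eigenvector(1)[OF nut x]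
          nut_graph_kernel_eigenvector(1)[OF nut x] count n
          has_parameters_some_edge[OF simple edges part(1) par]]
      show "k1 * k2 = d1 * d2" "k1 \<ge> 1 \<and> k2 \<ge> 1 \<and> d1 \<ge> 1 \<and> d2 \<ge> 1"
        "x $ v2 / x $ v1 = - (real k1 / real d1)"
        by (rule q)+
    qed
    have "gcd n1 n2 \<noteq> 1"
    proof
      assume "gcd n1 n2 = 1"
      then have "n1 * n2 \<le> d1 * d2"
        using coprime_imp_product_le[OF _ count] parameters(2)[OF y]
        by (simp add: coprime_iff_gcd_eq_1)
      moreover have "k1 < n1" "k2 < n2"
        using has_parameters_less[OF simple par ne(1)]
          has_parameters_less[OF simple has_parameters_swap[OF par] ne(2)] by auto
      then have "k1 * k2 < n1 * n2"
        by (intro mult_strict_mono) auto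
      ultimately show False
        using parameters(1)[OF y] by simp
    qed
    moreover have "\<exists>c. c \<noteq> 0 \<and> (\<forall>v\<in>V1. (c *s x) $ v = 1) \<and>
        (\<forall>v\<in>V2. (c *s x) $ v = - (real k1 / real d1))" if x: "kernel_eigenvector E x" for x
    proof -
      have nz: "x $ v1 \<noteq> 0"
        using nut x by (rule nut_graph_kernel_eigenvector)
      have "x $ w = x $ v1" if "w \<in> V1" for w
        using const[OF x V(1) that v(1)] .
      moreover have "x $ w = x $ v2" if "w \<in> V2" for w
        using const[OF x V(2) that v(2)] .
      ultimately show ?thesis
        using nz parameters(3)[OF x] by (intro exI[of _ "1 / x $ v1"]) simp
    qed
    ultimately show ?thesis
      using const V parameters(1,2)[OF y] by blast
  qed
  then show ?thesis
    using biregular_bidecomposition_vertex_orbits[OF subgroup vertex_orbits] by blast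
qed

end
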